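(* If $G$ is a 2-connected $K_{1,4}$-heavy graph, and $C$ is a longest cycle of $G$, then $C$ is a heavy cycle of $G$.
   Context: All graphs are finite and simple. Let $G$ be a graph on $n$ vertices. A vertex $v$ of $G$ is called heavy if its degree satisfies $d(v)\geq n/2$. A cycle $C$ of $G$ is called heavy if $C$ contains all heavy vertices of $G$. For a given graph $H$, the graph $G$ is called $H$-heavy if every induced subgraph of $G$ isomorphic to $H$ contains two vertices that are nonadjacent and whose degrees in $G$ have sum at least $n$. (In particular, a graph with no induced subgraph isomorphic to $H$ is $H$-heavy.) $K_{1,4}$ denotes the star with four leaves. *)

theory Defs
  imports "Graph_Theory.Graph_Theory"
begin

text \<open>
  A finite simple undirected graph is an element of the locale \<^locale>\<open>graph\<close>: a finite,
  loop-free, symmetric digraph without parallel arcs. An undirected edge \<open>uv\<close> is a pair of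
  opposite arcs, so the degree of \<open>v\<close> is \<open>out_degree G v\<close>, and \<open>u\<close>, \<open>v\<close> are adjacent
  iff \<open>u \<rightarrow>\<^bsub>G\<^esub> v\<close>.
\<close>

definition k_connected :: "nat \<Rightarrow> ('a, 'b) pre_digraph \<Rightarrow> bool" where
  "k_connected k G \<longleftrightarrow> card (verts G) > k \<and>
     (\<forall>X \<subseteq> verts G. card X < k \<longrightarrow> connected (G \<restriction> (verts G - X)))"

definition star_graph :: "nat \<Rightarrow> (nat, nat \<times> nat) pre_digraph" where
  "star_graph k = with_proj \<lparr>pverts = {0..k}, parcs = {0} \<times> {1..k} \<union> {1..k} \<times> {0}\<rparr>"

lemma star_graph_complete_bipartite: "complete_bipartite_digraph 1 k (star_graph k)"
proof -
  have "{0..k} = {0} \<union> {1..k} \<and> {0} \<inter> {1..k} = {} \<and> card {0} = 1 \<and> card {1..k} = k"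
    by auto
  then show ?thesis
    unfolding star_graph_def complete_bipartite_digraph_pair_def
    by (intro conjI exI[of _ "{0}"] exI[of _ "{1..k}"]) simp_all
qed

definition heavy_vertex :: "('a, 'b) pre_digraph \<Rightarrow> 'a \<Rightarrow> bool" where
  "heavy_vertex G v \<longleftrightarrow>
     v \<in> verts G \<and> real (out_degree G v) \<ge> real (card (verts G)) / 2"

definition graph_heavy :: "('c, 'd) pre_digraph \<Rightarrow> ('a, 'b) pre_digraph \<Rightarrow> bool" where
  "graph_heavy H G \<longleftrightarrow>
     (\<forall>F. induced_subgraph F G \<and> digraph_iso F H \<longrightarrow>
       (\<exists>u \<in> verts F. \<exists>v \<in> verts F. u \<noteq> v \<and> \<not> u \<rightarrow>\<^bsub>G\<^esub> v \<and>
          out_degree G u + out_degree G v \<ge> card (verts G)))"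

text \<open>
  A cycle is the list of arcs traversed in one direction from some starting vertex. The length
  bound excludes the closed walks \<open>u, v, u\<close> along a single edge, which
  \<^const>\<open>pre_digraph.cycle\<close> admits.
\<close>

definition graph_cycle :: "('a, 'b) pre_digraph \<Rightarrow> 'b list \<Rightarrow> bool" where
  "graph_cycle G C \<longleftrightarrow> pre_digraph.cycle G C \<and> length C \<ge> 3"

text \<open>Every vertex of a closed walk is the tail of an arc of the walk.\<close>

definition cycle_verts :: "('a, 'b) pre_digraph \<Rightarrow> 'b list \<Rightarrow> 'a set" where
  "cycle_verts G C = tail G ` set C"

definition longest_cycle :: "('a, 'b) pre_digraph \<Rightarrow> 'b list \<Rightarrow> bool" where
  "longest_cycle G C \<longleftrightarrow>
     graph_cycle G C \<and> (\<forall>D. graph_cycle G D \<longrightarrow> length D \<le> length C)"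

definition heavy_cycle :: "('a, 'b) pre_digraph \<Rightarrow> 'b list \<Rightarrow> bool" where
  "heavy_cycle G C \<longleftrightarrow>
     graph_cycle G C \<and> (\<forall>v. heavy_vertex G v \<longrightarrow> v \<in> cycle_verts G C)"

end

theory Submission
  imports Defs
begin

text \<open>
  Let \<open>F\<close> add to the edge relation \<open>E\<close> all pairs of vertices with degree sum at least \<open>n\<close>. By
  Ore's crossing argument every \<open>F\<close>-cycle yields an \<open>E\<close>-cycle that is at least as long, so \<open>C\<close>
  is a longest \<open>F\<close>-cycle, and four \<open>E\<close>-neighbours of a vertex are never \<open>F\<close>-independent.

  Suppose a heavy vertex \<open>x\<close> is not on \<open>C\<close>. Choose a longest path \<open>P\<close> with ends on \<open>C\<close> and interior
  off \<open>C\<close> through \<open>x\<close>, say with \<open>p\<close> inner vertices, \<open>m\<close> of which other than \<open>x\<close> are not adjacent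
  to \<open>x\<close>. Exchanging arcs of \<open>C\<close> shows \<open>|C| \<ge> 2k + 2p - 2\<close>, where \<open>k\<close> is the number of
  neighbours of \<open>x\<close> on \<open>C\<close>; as \<open>x\<close> is heavy, the set \<open>D\<close> of its neighbours off \<open>C\<close> and \<open>P\<close> has
  \<open>|D| \<ge> p + 2m\<close>. Let \<open>L\<close> be the interior of a longest path from \<open>x\<close> back to \<open>C\<close> or \<open>P\<close> that
  starts outside \<open>C\<close> and \<open>P\<close>, let \<open>a\<close> be its first vertex, and let \<open>s\<close>, \<open>t\<close> be the neighbours of
  \<open>x\<close> on \<open>P\<close>. Maximality makes \<open>s\<close> and \<open>t\<close> non-adjacent to \<open>D\<close>, and \<open>a\<close> non-adjacent to
  \<open>R = D - L\<close>. If \<open>s\<close>, \<open>t\<close> are not \<open>F\<close>-adjacent, then \<open>{s, t, a, r}\<close> shows that \<open>R\<close> is empty and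
  \<open>|L| \<ge> |D|\<close>. Otherwise \<open>{t, a, r, r'}\<close> shows that \<open>R\<close> is an \<open>F\<close>-clique; a path from \<open>x\<close> through
  all of \<open>R\<close> gives \<open>|L| \<ge> |R|\<close> and hence \<open>2|L| \<ge> |D|\<close>. Rerouting \<open>P\<close> along \<open>L\<close>, and in the second
  case along the edge \<open>st\<close> as well, contradicts the choice of \<open>P\<close>.
\<close>

section \<open>Ore-type edges and cycles\<close>

text \<open>Cycles are vertex lists over an arbitrary relation, because the enlarged relation
  \<open>F\<close> has no arcs of its own.\<close>

definition circuit :: "('a \<Rightarrow> 'a \<Rightarrow> bool) \<Rightarrow> 'a list \<Rightarrow> bool" where
  "circuit R xs \<longleftrightarrow> 3 \<le> length xs \<and> distinct xs \<and> successively R xs \<and> R (last xs) (hd xs)"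

lemma circuit_append_commute:
  assumes "circuit R (xs @ ys)"
  shows "circuit R (ys @ xs)"
  using assms unfolding circuit_def
  by (cases "xs = []"; cases "ys = []") (auto simp: successively_append_iff)

lemma successively_rev_sym:
  assumes "\<And>u v. R u v \<Longrightarrow> R v u" "successively R xs"
  shows "successively R (rev xs)"
  using assms by (auto simp: successively_rev intro: successively_mono)

lemma length_filter_no_two_successive:
  assumes "successively (\<lambda>u v. \<not> (P u \<and> P v)) xs"
  shows "2 * length (filter P xs) \<le> length xs + 1"
  using assms
proof (induction xs rule: induct_list012)
  case (3 x y zs)
  then have "successively (\<lambda>u v. \<not> (P u \<and> P v)) zs"
    by (cases zs) auto
  with 3 show ?case by auto
qed auto

text \<open>The first \<open>a\<close> and the last \<open>b\<close> entries fail \<open>P\<close>,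
  so the previous bound is applied to the middle segment alone. If no entry satisfies
  \<open>P\<close>, the margins say nothing and \<open>len\<close> is the claim.\<close>

lemma length_filter_margins:
  assumes no_two: "successively (\<lambda>u v. \<not> (P u \<and> P v)) xs"
    and left: "\<And>ys y zs. xs = ys @ y # zs \<Longrightarrow> P y \<Longrightarrow> a \<le> length ys"
    and right: "\<And>ys y zs. xs = ys @ y # zs \<Longrightarrow> P y \<Longrightarrow> b \<le> length zs"
    and len: "a + b \<le> length xs + 1"
  shows "2 * length (filter P xs) + a + b \<le> length xs + 1"
proof (cases "filter P xs = []")
  case False
  then obtain y where y: "y \<in> set xs" "P y" by (auto simp: filter_empty_conv)
  obtain ys zs where yz: "xs = ys @ y # zs" using y(1) by (meson split_list)
  have ab: "a \<le> length ys" "b \<le> length zs"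
    using left[OF yz y(2)] right[OF yz y(2)] by auto
  define us where "us = take a xs"
  define ms where "ms = take (length xs - b - a) (drop a xs)"
  define vs where "vs = drop (length xs - b) xs"
  have le: "a + b \<le> length xs" using ab yz by simp
  have xs: "xs = us @ ms @ vs"
    using le unfolding us_def ms_def vs_def
    by (metis append_take_drop_id drop_drop le_add_diff_inverse2 add_le_imp_le_diff add.commute)
  have lens: "length us = a" "length vs = b"
    using le by (auto simp: us_def vs_def)
  have "\<not> P p" if pin: "p \<in> set us" for p
  proof
    assume "P p"
    obtain k l where "us = k @ p # l" using split_list[OF pin] by blast
    with left[of k p "l @ ms @ vs"] \<open>P p\<close> xs lens show False by auto
  qed
  moreover have "\<not> P p" if pin: "p \<in> set vs" for p
  proof
    assume "P p"
    obtain k l where "vs = k @ p # l" using split_list[OF pin] by blast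
    with right[of "us @ ms @ k" p l] \<open>P p\<close> xs lens show False by auto
  qed
  ultimately have "filter P xs = filter P ms"
    by (subst xs) (auto simp: filter_empty_conv)
  moreover have "2 * length (filter P ms) \<le> length ms + 1"
    using no_two by (intro length_filter_no_two_successive) (subst (asm) xs, auto simp: successively_append_iff)
  moreover have "length xs = a + length ms + b"
    using xs lens by (metis length_append add.assoc)
  ultimately show ?thesis by simp
qed (use len in simp)

section \<open>Ore's crossing argument\<close>

locale simple_graph =
  fixes V :: "'a set" and E :: "'a \<Rightarrow> 'a \<Rightarrow> bool"
  assumes finite_V: "finite V"
    and E_sym: "E u v \<Longrightarrow> E v u"
    and E_in: "E u v \<Longrightarrow> u \<in> V"
    and E_irrefl: "\<not> E u u"
begin

abbreviation deg :: "'a \<Rightarrow> nat" where "deg v \<equiv> card {u. E v u}"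

lemma E_in2: "E u v \<Longrightarrow> v \<in> V" using E_in E_sym by blast

lemma finite_nbrs: "finite {u. E v u}"
  using finite_V by (rule rev_finite_subset) (auto dest: E_in2)

text \<open>The path runs in \<open>R\<close>, but degrees are counted in \<open>E\<close>, so every
  edge added to close it lies in \<open>E\<close>. Either a common neighbour of the two ends off the
  path closes it, or their neighbourhoods off the path are disjoint and the pigeonhole principle
  yields crossing chords.\<close>

lemma circuit_from_path:
  assumes R_sym: "\<And>u v. R u v \<Longrightarrow> R v u" and ER: "\<And>u v. E u v \<Longrightarrow> R u v"
    and xs: "distinct xs" "successively R xs" "set xs \<subseteq> V" "3 \<le> length xs"
    and deg: "card V \<le> deg (hd xs) + deg (last xs)"
  shows "\<exists>ys. circuit R ys \<and> length xs \<le> length ys"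
proof -
  define u v l where "u = hd xs" and "v = last xs" and "l = length xs"
  have ne: "xs \<noteq> []" using xs by auto
  have u0: "u = xs ! 0" using ne by (simp add: u_def hd_conv_nth)
  have vl: "v = xs ! (l - 1)" using ne by (simp add: v_def l_def last_conv_nth)
  show ?thesis
  proof (cases "\<exists>z. z \<notin> set xs \<and> E u z \<and> E v z")
    case True
    then obtain z where z: "z \<notin> set xs" "E u z" "E v z" by blast
    have "circuit R (z # xs)"
      using xs z ne R_sym ER by (auto simp: circuit_def successively_Cons u_def v_def)
    then show ?thesis by force
  next
    case False
    \<comment> \<open>Both sets consist of steps \<open>i\<close> of the path: in \<open>S\<close>
      the later endpoint is adjacent to \<open>u\<close>, in \<open>T\<close> the earlier one to
      \<open>v\<close>.\<close>
    define S where "S = {i. Suc i < l \<and> E u (xs ! Suc i)}"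
    define T where "T = {i. Suc i < l \<and> E v (xs ! i)}"
    have fin: "finite S" "finite T"
      by (auto simp: S_def T_def intro: finite_subset[of _ "{..<l}"])
    have "{z. E u z} \<inter> set xs \<subseteq> (\<lambda>i. xs ! Suc i) ` S"
    proof
      fix z assume z: "z \<in> {z. E u z} \<inter> set xs"
      then obtain j where j: "j < l" "z = xs ! j" by (auto simp: in_set_conv_nth l_def)
      moreover have "j \<noteq> 0" using z j u0 E_irrefl[of u] by (intro notI) auto
      ultimately obtain i where "j = Suc i" by (cases j) auto
      then show "z \<in> (\<lambda>i. xs ! Suc i) ` S" using z j by (auto simp: S_def)
    qed
    then have cS: "card ({z. E u z} \<inter> set xs) \<le> card S"
      using fin by (meson card_image_le card_mono finite_imageI le_trans)
    have "{z. E v z} \<inter> set xs \<subseteq> (\<lambda>i. xs ! i) ` T"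
    proof
      fix z assume z: "z \<in> {z. E v z} \<inter> set xs"
      then obtain j where j: "j < l" "z = xs ! j" by (auto simp: in_set_conv_nth l_def)
      moreover have "j \<noteq> l - 1" using z j vl E_irrefl[of v] by (intro notI) auto
      ultimately have "Suc j < l" by auto
      then show "z \<in> (\<lambda>i. xs ! i) ` T" using z j by (auto simp: T_def)
    qed
    then have cT: "card ({z. E v z} \<inter> set xs) \<le> card T"
      using fin by (meson card_image_le card_mono finite_imageI le_trans)
    have disj: "({z. E u z} - set xs) \<inter> ({z. E v z} - set xs) = {}"
      using False by auto
    have "card ({z. E u z} - set xs) + card ({z. E v z} - set xs)
        = card (({z. E u z} - set xs) \<union> ({z. E v z} - set xs))"
      using disj finite_nbrs by (subst card_Un_disjoint) auto
    also have "\<dots> \<le> card (V - set xs)"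
      using finite_V by (intro card_mono) (auto dest: E_in2)
    also have "\<dots> = card V - l"
      using xs by (simp add: card_Diff_subset distinct_card l_def)
    finally have out: "card ({z. E u z} - set xs) + card ({z. E v z} - set xs) \<le> card V - l" .
    have "l \<le> card V"
      using card_mono[OF finite_V xs(3)] xs(1) by (simp add: distinct_card l_def)
    moreover have "deg u = card ({z. E u z} \<inter> set xs) + card ({z. E u z} - set xs)"
      "deg v = card ({z. E v z} \<inter> set xs) + card ({z. E v z} - set xs)"
      using finite_nbrs by (auto intro: card_Int_Diff)
    ultimately have "l \<le> card S + card T"
      using deg out cS cT by (simp add: u_def v_def)
    \<comment> \<open>The path has only \<open>l - 1\<close> steps, whereas the sizes of
      \<open>S\<close> and \<open>T\<close> add up to at least \<open>l\<close>; hence they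
      meet.\<close>
    moreover have "card (S \<union> T) \<le> l - 1"
    proof -
      have "S \<union> T \<subseteq> {..<l - 1}" by (auto simp: S_def T_def)
      then show ?thesis using card_mono[of "{..<l - 1}"] by force
    qed
    moreover have "l \<ge> 3" using xs by (simp add: l_def)
    ultimately have "S \<inter> T \<noteq> {}"
      using fin card_Un_disjoint[of S T] by auto
    then obtain i where i: "Suc i < l" "E u (xs ! Suc i)" "E v (xs ! i)"
      by (auto simp: S_def T_def)
    \<comment> \<open>Go from \<open>u\<close> to \<open>xs ! i\<close>, take the chord to
      \<open>v\<close>, run backwards to \<open>xs ! Suc i\<close> and close up at
      \<open>u\<close>.\<close>
    define ys where "ys = take (Suc i) xs @ rev (drop (Suc i) xs)"
    have split: "successively R (take (Suc i) xs)" "successively R (drop (Suc i) xs)"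
      using xs(2) successively_append_iff[of R "take (Suc i) xs" "drop (Suc i) xs"] by auto
    have "last (take (Suc i) xs) = xs ! i"
      using i by (simp add: take_Suc_conv_app_nth l_def)
    moreover have "hd (rev (drop (Suc i) xs)) = v"
      using i by (simp add: hd_rev v_def l_def)
    moreover have "last ys = xs ! Suc i"
      using i by (simp add: ys_def last_rev hd_drop_conv_nth l_def)
    moreover have "hd ys = u"
      using ne by (simp add: ys_def u_def)
    moreover have "successively R (rev (drop (Suc i) xs))"
      using R_sym split(2) by (rule successively_rev_sym)
    moreover have "distinct ys"
      using xs(1) by (auto simp: ys_def set_take_disj_set_drop_if_distinct)
    moreover have "length ys = l" using i by (simp add: ys_def l_def)
    ultimately have "circuit R ys"
      using split i R_sym ER \<open>l \<ge> 3\<close>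
      by (auto simp: circuit_def ys_def successively_append_iff)
    with \<open>length ys = l\<close> show ?thesis by (auto simp: l_def)
  qed
qed

text \<open>The added pairs are eliminated one at a time. Degrees always refer to \<open>E\<close>,
  so the degree hypothesis survives; a circuit through the pair, opened there, is a path for
  \<open>circuit_from_path\<close>.\<close>

lemma circuit_add_ore_edges:
  assumes "finite F"
    and "\<And>u v. (u, v) \<in> F \<Longrightarrow> u \<in> V \<and> v \<in> V \<and> card V \<le> deg u + deg v"
    and "circuit (\<lambda>u v. E u v \<or> (u, v) \<in> F \<or> (v, u) \<in> F) xs"
  shows "\<exists>ys. circuit E ys \<and> length xs \<le> length ys"
  using assms
proof (induction F arbitrary: xs rule: finite_induct)
  case empty
  then show ?case by auto
next
  case (insert e F)
  obtain u v where e: "e = (u, v)" by (cases e)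
  define R where "R = (\<lambda>u v. E u v \<or> (u, v) \<in> F \<or> (v, u) \<in> F)"
  define R' where "R' = (\<lambda>u v. E u v \<or> (u, v) \<in> insert e F \<or> (v, u) \<in> insert e F)"
  have IH: "\<exists>ys. circuit E ys \<and> length zs \<le> length ys" if "circuit R zs" for zs
    using insert.IH[of zs] insert.prems(1) that by (auto simp: R_def)
  have R'R: "R' a b \<Longrightarrow> \<not> R a b \<Longrightarrow> {a, b} = {u, v}" for a b
    by (auto simp: R_def R'_def e)
  have uv: "u \<in> V" "v \<in> V" "card V \<le> deg u + deg v" using insert.prems(1) e by auto
  have key: ?case if c: "circuit R' zs" and close: "\<not> R (last zs) (hd zs)"
    and len: "length zs = length xs" for zs
  proof -
    have l3: "3 \<le> length zs" and d: "distinct zs" and s: "successively R' zs"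
      using c by (auto simp: circuit_def)
    have ends: "{last zs, hd zs} = {u, v}" using c close R'R by (auto simp: circuit_def)
    have ne: "zs \<noteq> []" using l3 by auto
    \<comment> \<open>The pair already joins the last entry to the first; in a distinct list of at
      least three entries it cannot also be an inner step.\<close>
    have "R (zs ! i) (zs ! Suc i)" if i: "Suc i < length zs" for i
    proof (rule ccontr)
      assume "\<not> R (zs ! i) (zs ! Suc i)"
      then have "{zs ! i, zs ! Suc i} = {last zs, hd zs}"
        using R'R successively_nth[OF s i] ends by metis
      then have "{zs ! i, zs ! Suc i} = {zs ! (length zs - 1), zs ! 0}"
        using ne by (simp add: hd_conv_nth last_conv_nth)
      then consider "zs ! i = zs ! (length zs - 1)"
        | "zs ! i = zs ! 0" "zs ! Suc i = zs ! (length zs - 1)"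
        unfolding doubleton_eq_iff by blast
      then show False
      proof cases
        case 1
        then have "i = length zs - 1"
          using nth_eq_iff_index_eq[OF d, of i "length zs - 1"] i by linarith
        then show False using i by linarith
      next
        case 2
        then have "i = 0" "Suc i = length zs - 1"
          using nth_eq_iff_index_eq[OF d, of i 0]
            nth_eq_iff_index_eq[OF d, of "Suc i" "length zs - 1"] i by linarith+
        then show False using l3 by linarith
      qed
    qed
    then have sR: "successively R zs" by (auto simp: successively_conv_nth)
    have in_V: "set zs \<subseteq> V"
    proof
      fix z assume "z \<in> set zs"
      then obtain i where i: "i < length zs" "z = zs ! i" by (auto simp: in_set_conv_nth)
      have "\<exists>b. R' z b \<or> R' b z"
      proof (cases "Suc i < length zs")
        case True
        then show ?thesis using successively_nth[OF s True] i by auto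
      next
        case False
        then have "i = length zs - 1" using i by auto
        then have "z = last zs" using i ne by (simp add: last_conv_nth)
        then show ?thesis using c by (auto simp: circuit_def)
      qed
      then show "z \<in> V" using insert.prems(1) E_in E_in2 by (auto simp: R'_def)
    qed
    have "card V \<le> deg (hd zs) + deg (last zs)"
      using ends uv by (auto simp: doubleton_eq_iff)
    then obtain ys where "circuit R ys" "length zs \<le> length ys"
      using circuit_from_path[of R zs] E_sym d sR in_V l3 by (auto simp: R_def)
    with IH[of ys] len show ?thesis by fastforce
  qed
  have c: "circuit R' xs" using insert.prems(2) by (simp add: R'_def)
  show ?case
  proof (cases "R (last xs) (hd xs) \<and> successively R xs")
    case True
    then show ?thesis using c IH[of xs] by (auto simp: circuit_def)
  next
    case False
    show ?thesis
    proof (cases "R (last xs) (hd xs)")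
      case True
      with False obtain i where i: "Suc i < length xs" "\<not> R (xs ! i) (xs ! Suc i)"
        by (auto simp: successively_conv_nth)
      \<comment> \<open>Rotation brings the step outside \<open>R\<close> to the closing position
        that \<open>key\<close> expects.\<close>
      define zs where "zs = drop (Suc i) xs @ take (Suc i) xs"
      have "circuit R' zs"
        using circuit_append_commute[of R' "take (Suc i) xs" "drop (Suc i) xs"] c
        by (simp add: zs_def)
      moreover have "last zs = xs ! i" "hd zs = xs ! Suc i"
        using i by (auto simp: zs_def take_Suc_conv_app_nth hd_drop_conv_nth)
      moreover have "length zs = length xs" using i by (simp add: zs_def)
      ultimately show ?thesis using key i by simp
    qed (use key c in simp)
  qed
qed

end

section \<open>Two-connected graphs\<close>

lemma successively_join:
  assumes "successively R (xs @ [y])" "successively R (y # ys)"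
  shows "successively R (xs @ y # ys)"
  using assms by (auto simp: successively_append_iff)

lemma successively_split:
  assumes "successively R (xs @ y # ys)"
  shows "successively R (xs @ [y])" "successively R (y # ys)"
  using assms by (auto simp: successively_append_iff)

text \<open>Let \<open>Z\<close> collect what is reached from \<open>S\<close> by paths with
  interior off \<open>S\<close> and \<open>T\<close>. If \<open>Z\<close> misses \<open>T\<close>,
  then \<open>cut\<close> gives an edge leaving \<open>Z\<close>, which prolongs such a path to a
  vertex outside \<open>Z\<close>.\<close>

lemma (in simple_graph) connecting_path:
  assumes cut: "\<And>Z. Z \<subseteq> U \<Longrightarrow> Z \<noteq> {} \<Longrightarrow> Z \<noteq> U \<Longrightarrow> \<exists>a\<in>Z. \<exists>b\<in>U - Z. E a b"
    and ST: "S \<subseteq> U" "T \<subseteq> U" "S \<inter> T = {}" "S \<noteq> {}" "T \<noteq> {}"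
  shows "\<exists>a L b. a \<in> S \<and> b \<in> T \<and> distinct L \<and> set L \<subseteq> U - (S \<union> T) \<and> successively E (a # L @ [b])"
proof (rule ccontr)
  assume no: "\<not> ?thesis"
  define p where "p a L b \<longleftrightarrow> a \<in> S \<and> distinct L \<and> set L \<subseteq> U - (S \<union> T) \<and> b \<notin> set L
    \<and> successively E (a # L @ [b])" for a L b
  define Z where "Z = S \<union> {b \<in> U. \<exists>a L. p a L b}"
  have ZT: "Z \<inter> T = {}" using no ST(3) by (auto simp: Z_def p_def)
  moreover have "Z \<subseteq> U" "Z \<noteq> {}" using ST by (auto simp: Z_def)
  ultimately have "Z \<subseteq> U" "Z \<noteq> {}" "Z \<noteq> U" using ST by blast+
  then obtain y z where yz: "y \<in> Z" "z \<in> U" "z \<notin> Z" "E y z"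
    using cut by blast
  have nz: "\<not> p a L z" for a L using yz by (auto simp: Z_def)
  show False
  proof (cases "y \<in> S")
    case True
    then have "p y [] z" using yz by (auto simp: p_def)
    with nz show False by simp
  next
    case False
    then obtain a L where aL: "p a L y" and yU: "y \<in> U" using yz by (auto simp: Z_def)
    have "z \<notin> set L"
    proof
      assume "z \<in> set L"
      then obtain L1 L2 where L: "L = L1 @ z # L2" by (meson split_list)
      then have "p a L1 z"
        using aL by (auto simp: p_def successively_append_iff successively_Cons hd_append split: if_splits)
      with nz show False by simp
    qed
    moreover have "y \<noteq> z" using yz by auto
    ultimately have "p a (L @ [y]) z"
      using aL yz yU False ZT
      by (auto simp: p_def successively_append_iff successively_Cons hd_append split: if_splits)
    with nz show False by simp
  qed
qed

text \<open>Connectivity is phrased through edges leaving a set because both path constructions grow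
  a set of reached vertices.\<close>

locale two_connected_graph = simple_graph +
  assumes cut: "X \<subseteq> V \<Longrightarrow> card X < 2 \<Longrightarrow> Z \<subseteq> V - X \<Longrightarrow> Z \<noteq> {} \<Longrightarrow> Z \<noteq> V - X
    \<Longrightarrow> \<exists>a\<in>Z. \<exists>b\<in>V - X - Z. E a b"
begin

lemma path_avoiding:
  assumes "v \<in> V" "S \<subseteq> V - {v}" "T \<subseteq> V - {v}" "S \<inter> T = {}" "S \<noteq> {}" "T \<noteq> {}"
  obtains a L b where "a \<in> S" "b \<in> T" "distinct L" "set L \<subseteq> V - {v} - (S \<union> T)"
    "successively E (a # L @ [b])"
  using connecting_path[of "V - {v}" S T] cut[of "{v}"] assms by auto

text \<open>The fan lemma for two paths, grown along edges leaving the set of vertices it covers.\<close>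

lemma ear_through:
  assumes X: "X \<subseteq> V" "2 \<le> card X" and x: "x \<in> V - X"
  shows "\<exists>w A B w'. w \<in> X \<and> w' \<in> X \<and> w \<noteq> w' \<and> distinct (A @ x # B)
    \<and> set (A @ x # B) \<subseteq> V - X \<and> successively E (w # A @ x # B @ [w'])"
proof -
  define ear where "ear w A y B w' \<longleftrightarrow> w \<in> X \<and> w' \<in> X \<and> w \<noteq> w' \<and> distinct (A @ y # B)
    \<and> set (A @ y # B) \<subseteq> V - X \<and> successively E (w # A @ y # B @ [w'])" for w A y B w'
  \<comment> \<open>If \<open>Z\<close> is not everything, an edge from some \<open>v\<close> in
    \<open>Z\<close> to some \<open>y\<close> outside leaves it, and an ear through \<open>y\<close>
    is built.\<close>
  define Z where "Z = X \<union> {y. \<exists>w A B w'. ear w A y B w'}"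
  have rev_E: "successively E (rev xs)" if "successively E xs" for xs
    using E_sym that by (rule successively_rev_sym)
  have "Z = V"
  proof (rule ccontr)
    assume "Z \<noteq> V"
    moreover have ZV: "Z \<subseteq> V" using X by (auto simp: Z_def ear_def)
    moreover have "Z \<noteq> {}" using X by (auto simp: Z_def)
    ultimately obtain v y where vy: "v \<in> Z" "y \<in> V" "y \<notin> Z" "E v y"
      using cut[of "{}" Z] by auto
    have yX: "y \<notin> X" and ny: "\<not> ear w A y B w'" for w A B w'
      using vy by (auto simp: Z_def)
    have yv: "y \<noteq> v" using vy by auto
    show False
    proof (cases "v \<in> X")
      case True
      have ne: "X - {v} \<noteq> {}"
      proof
        assume "X - {v} = {}"
        then have "card X \<le> card {v}" by (intro card_mono) auto
        with X(2) show False by simp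
      qed
      have "v \<in> V" "{y} \<subseteq> V - {v}" "X - {v} \<subseteq> V - {v}" "{y} \<inter> (X - {v}) = {}" "{y} \<noteq> {}"
        using vy yX yv X ZV by auto
      then obtain a L b where L: "a \<in> {y}" "b \<in> X - {v}" "distinct L"
        "set L \<subseteq> V - {v} - ({y} \<union> (X - {v}))" "successively E (a # L @ [b])"
        using ne by (rule path_avoiding)
      then have "ear v [] y L b"
        using True vy yX by (auto simp: ear_def successively_Cons)
      with ny show False by simp
    next
      case False
      then obtain w A B w' where e: "ear w A v B w'" using vy by (auto simp: Z_def)
      have yAB: "y \<notin> set A" "y \<notin> set B"
      proof -
        show "y \<notin> set A"
        proof
          assume "y \<in> set A"
          then obtain A1 A2 where "A = A1 @ y # A2" by (meson split_list)
          then have "ear w A1 y (A2 @ v # B) w'" using e by (auto simp: ear_def)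
          with ny show False by simp
        qed
        show "y \<notin> set B"
        proof
          assume "y \<in> set B"
          then obtain B1 B2 where "B = B1 @ y # B2" by (meson split_list)
          then have "ear w (A @ v # B1) y B2 w'" using e by (auto simp: ear_def)
          with ny show False by simp
        qed
      qed
      let ?T = "X \<union> set A \<union> set B"
      have ne: "?T \<noteq> {}" using e by (auto simp: ear_def)
      have "?T \<subseteq> V - {v}" using e X False by (auto simp: ear_def)
      then have "v \<in> V" "{y} \<subseteq> V - {v}" "?T \<subseteq> V - {v}" "{y} \<inter> ?T = {}" "{y} \<noteq> {}"
        using vy yX yv yAB ZV by auto
      then obtain a L z where L: "a \<in> {y}" "z \<in> ?T" "distinct L"
        "set L \<subseteq> V - {v} - ({y} \<union> ?T)" "successively E (a # L @ [z])"
        using ne by (rule path_avoiding)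
      have revL: "successively E (z # rev L @ [y])"
        using rev_E[OF L(5)] L(1) by simp
      have eA: "successively E ((w # A) @ [v])" and eB: "successively E (v # B @ [w'])"
        using e successively_split[of E "w # A" v "B @ [w']"] by (auto simp: ear_def)
      have vyL: "successively E (v # y # L @ [z])"
        using L vy by simp
      have yvB: "successively E (y # (v # B) @ [w'])"
        using eB E_sym[OF vy(4)] by simp
      \<comment> \<open>The edge \<open>vy\<close> and the new path are combined with the old ear.
        If they land on \<open>X\<close>, the half of the old ear ending at a different vertex is
        kept; if they land on \<open>B\<close> or \<open>A\<close>, the detour replaces the segment
        between \<open>v\<close> and \<open>z\<close>.\<close>
      consider "z \<in> X" "z \<noteq> w" | "z \<in> X" "z \<noteq> w'" | B1 B2 where "B = B1 @ z # B2"
        | A1 A2 where "A = A1 @ z # A2"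
        using L(2) e by (auto simp: ear_def dest!: split_list)
      then show False
      proof cases
        case 1
        have "successively E (w # (A @ [v]) @ y # L @ [z])"
          using successively_join[OF eA vyL] by simp
        then have "ear w (A @ [v]) y L z"
          using 1 e L vy yX yAB yv by (auto simp: ear_def)
        with ny show False by simp
      next
        case 2
        have "successively E (z # rev L @ y # (v # B) @ [w'])"
          using successively_join[of E "z # rev L" y "(v # B) @ [w']"] revL yvB by simp
        then have "ear z (rev L) y (v # B) w'"
          using 2 e L vy yX yAB yv by (auto simp: ear_def)
        with ny show False by simp
      next
        case 3
        have "successively E (z # B2 @ [w'])"
          using successively_split(2)[of E "v # B1" z "B2 @ [w']"] eB 3 by simp
        then have "successively E (v # y # L @ z # B2 @ [w'])"
          using successively_join[of E "v # y # L" z] vyL by simp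
        then have "successively E (w # (A @ [v]) @ y # (L @ z # B2) @ [w'])"
          using successively_join[OF eA] by simp
        then have "ear w (A @ [v]) y (L @ z # B2) w'"
          using 3 e L vy yX yAB yv by (auto simp: ear_def)
        with ny show False by simp
      next
        case 4
        have "successively E (w # A1 @ [z])"
          using successively_split(1)[of E "w # A1" z "A2 @ [v]"] eA 4 by simp
        moreover have "successively E (z # rev L @ y # v # B @ [w'])"
          using successively_join[of E "z # rev L" y "(v # B) @ [w']"] revL yvB by simp
        ultimately have "successively E (w # (A1 @ z # rev L) @ y # (v # B) @ [w'])"
          using successively_join[of E "w # A1" z] by simp
        then have "ear w (A1 @ z # rev L) y (v # B) w'"
          using 4 e L vy yX yAB yv by (auto simp: ear_def)
        with ny show False by simp
      qed
    qed
  qed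
  then have "\<exists>w A B w'. ear w A x B w'" using x by (auto simp: Z_def)
  then show ?thesis unfolding ear_def .
qed

end

section \<open>A heavy vertex off a longest cycle\<close>

text \<open>The counterexample situation, refuted by \<open>inconsistent\<close>. Degrees occur
  explicitly only in \<open>heavy\<close>; the degree sums of pairs are absorbed into
  \<open>F\<close>.\<close>

locale off_longest_circuit = two_connected_graph +
  fixes F :: "'a \<Rightarrow> 'a \<Rightarrow> bool" and C :: "'a list" and x :: 'a
  assumes F_sym: "F u v \<Longrightarrow> F v u"
    and EF: "E u v \<Longrightarrow> F u v"
    and C: "circuit F C" "set C \<subseteq> V"
    and longest: "circuit F ys \<Longrightarrow> length ys \<le> length C"
    and x: "x \<in> V" "x \<notin> set C"
    and heavy: "card V \<le> 2 * deg x"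
    and no_claw: "E x a \<Longrightarrow> E x b \<Longrightarrow> E x c \<Longrightarrow> E x d \<Longrightarrow> distinct [a, b, c, d]
      \<Longrightarrow> F a b \<or> F a c \<or> F a d \<or> F b c \<or> F b d \<or> F c d"
begin

text \<open>The edges at \<open>x\<close> are taken from \<open>E\<close>, not merely from \<open>F\<close>: the centre of an induced
  star must be joined to its leaves by edges of the graph itself. The same holds for the first edge
  of a leg.\<close>

definition ear :: "'a \<Rightarrow> 'a list \<Rightarrow> 'a list \<Rightarrow> 'a \<Rightarrow> bool" where
  "ear w A B w' \<longleftrightarrow> w \<in> set C \<and> w' \<in> set C \<and> w \<noteq> w' \<and> distinct (A @ x # B)
    \<and> set A \<subseteq> V - set C \<and> set B \<subseteq> V - set C
    \<and> successively F (w # A) \<and> E (last (w # A)) x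
    \<and> E x (hd (B @ [w'])) \<and> successively F (B @ [w'])"

definition max_ear :: "'a \<Rightarrow> 'a list \<Rightarrow> 'a list \<Rightarrow> 'a \<Rightarrow> bool" where
  "max_ear w A B w' \<longleftrightarrow> ear w A B w' \<and>
     (\<forall>u A' B' u'. ear u A' B' u' \<longrightarrow> length A' + length B' \<le> length A + length B)"

definition leg :: "'a list \<Rightarrow> 'a list \<Rightarrow> 'a list \<Rightarrow> 'a \<Rightarrow> bool" where
  "leg A B L q \<longleftrightarrow> L \<noteq> [] \<and> distinct L \<and> set L \<subseteq> V - (set C \<union> set A \<union> set B \<union> {x})
    \<and> E x (hd L) \<and> successively F (L @ [q]) \<and> q \<in> set C \<union> set A \<union> set B"

text \<open>The set \<open>D\<close> of the opening outline.\<close>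

definition outer :: "'a list \<Rightarrow> 'a list \<Rightarrow> 'a set" where
  "outer A B = {z \<in> V - (set C \<union> set A \<union> set B \<union> {x}). E x z}"

lemma rev_F: "successively F xs \<Longrightarrow> successively F (rev xs)"
  using F_sym by (rule successively_rev_sym)

lemma ear_reverse:
  assumes "ear w A B w'"
  shows "ear w' (rev B) (rev A) w"
  using assms rev_F[of "w # A"] rev_F[of "B @ [w']"] E_sym[of "last (w # A)" x] E_sym[of x "hd (B @ [w'])"]
  unfolding ear_def by (auto simp: last_rev hd_rev hd_append split: if_splits)

lemma max_ear_reverse:
  assumes "max_ear w A B w'"
  shows "max_ear w' (rev B) (rev A) w"
  using assms ear_reverse unfolding max_ear_def by (auto simp: add.commute)

section \<open>Exchanging arcs of the longest circuit\<close>

lemma ear_path: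
  assumes "ear w A B w'"
  shows "successively F (w # A @ x # B @ [w'])"
proof -
  have "successively F ((w # A) @ [x])"
    using assms EF unfolding ear_def successively_append_iff by auto
  moreover have "successively F (x # B @ [w'])"
    using assms EF unfolding ear_def successively_Cons by auto
  ultimately show ?thesis using successively_join[of F "w # A" x] by simp
qed

text \<open>Replacing the arc \<open>C1\<close> by the detour \<open>I\<close> gives a circuit,
  which cannot be longer than \<open>C\<close>. Only the length of \<open>C\<close> is prescribed,
  so that any rotation can be used. An empty detour is split off because the new list could be too
  short for a circuit.\<close>

lemma arc_ge:
  assumes circ: "circuit F (w # C1 @ w' # C2)" and len: "length (w # C1 @ w' # C2) = length C"
    and I: "distinct I" "set I \<inter> set (w # C1 @ w' # C2) = {}" "successively F (w # I @ [w'])"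
  shows "length I \<le> length C1"
proof (cases "I = []")
  case False
  have "successively F (w' # C2)"
    using circ successively_split(2)[of F "w # C1" w' C2] by (simp add: circuit_def)
  then have "successively F (w # I @ w' # C2)"
    using successively_join[of F "w # I" w' C2] I(3) by simp
  moreover have "3 \<le> length (w # I @ w' # C2)" using False by (cases I) auto
  ultimately have "circuit F (w # I @ w' # C2)"
    using circ I unfolding circuit_def by auto
  from longest[OF this] len show ?thesis by simp
qed simp

text \<open>Three detours feed \<open>length_filter_margins\<close>: \<open>x\<close> alone forbids
  consecutive neighbours of \<open>x\<close> on the arc, \<open>A\<close> with \<open>x\<close>
  forces a margin before each neighbour, and \<open>x\<close> with \<open>B\<close> one after it.
  The whole ear serves as detour when the arc has no neighbour of \<open>x\<close>.\<close>

lemma arc_long: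
  assumes circ: "circuit F (w # C1 @ w' # C2)" and len: "length (w # C1 @ w' # C2) = length C"
    and CC: "set (w # C1 @ w' # C2) = set C" and ear: "ear w A B w'"
  shows "2 * length (filter (E x) C1) + length A + length B + 1 \<le> length C1"
proof -
  have AB: "distinct A" "distinct B" "x \<notin> set A" "x \<notin> set B" "set A \<inter> set C = {}" "set B \<inter> set C = {}"
    "set A \<inter> set B = {}"
    using ear by (auto simp: ear_def)
  have path: "successively F (w # A @ x # B @ [w'])" using ear by (rule ear_path)
  have wAx: "successively F (w # A @ [x])" and xBw: "successively F (x # B @ [w'])"
    using successively_split[of F "w # A" x "B @ [w']"] path by auto
  have "2 * length (filter (E x) C1) + (length A + 1) + (length B + 1) \<le> length C1 + 1"
  proof (rule length_filter_margins)
    show "successively (\<lambda>u v. \<not> (E x u \<and> E x v)) C1"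
    proof (rule ccontr)
      assume "\<not> ?thesis"
      then obtain i where i: "Suc i < length C1" "E x (C1 ! i)" "E x (C1 ! Suc i)"
        by (auto simp: successively_conv_nth)
      define us a b vs where "us = take i C1" and "a = C1 ! i" and "b = C1 ! Suc i"
        and "vs = drop (Suc (Suc i)) C1"
      have C1: "C1 = us @ a # b # vs"
        using i by (simp add: us_def a_def b_def vs_def Cons_nth_drop_Suc)
      have circ': "circuit F ((a # b # vs @ w' # C2) @ w # us)"
        using circuit_append_commute[of F "w # us" "a # b # vs @ w' # C2"] circ by (simp add: C1)
      \<comment> \<open>The arc between the consecutive vertices \<open>a\<close> and
        \<open>b\<close> is empty, so inserting \<open>x\<close> there yields an absurd
        inequality.\<close>
      have "length [x] \<le> length ([] :: 'a list)"
      proof (rule arc_ge[of a "[]" b "vs @ w' # C2 @ w # us"])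
        show "successively F (a # [x] @ [b])" using i EF E_sym by (simp add: a_def b_def)
        show "set [x] \<inter> set (a # [] @ b # vs @ w' # C2 @ w # us) = {}" using x CC by (auto simp: C1)
      qed (use circ' len in \<open>auto simp: C1\<close>)
      then show False by simp
    qed
  next
    fix ys y zs assume C1: "C1 = ys @ y # zs" and y: "E x y"
    have "length (A @ [x]) \<le> length ys"
    proof (rule arc_ge[of w ys y "zs @ w' # C2"])
      show "successively F (w # (A @ [x]) @ [y])"
        using successively_join[of F "w # A" x "[y]"] wAx y EF by simp
      show "set (A @ [x]) \<inter> set (w # ys @ y # zs @ w' # C2) = {}" using AB x CC by (auto simp: C1)
    qed (use circ len AB in \<open>auto simp: C1\<close>)
    then show "length A + 1 \<le> length ys" by simp
    have circ': "circuit F ((y # zs @ w' # C2) @ w # ys)"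
      using circuit_append_commute[of F "w # ys" "y # zs @ w' # C2"] circ by (simp add: C1)
    have "length (x # B) \<le> length zs"
    proof (rule arc_ge[of y zs w' "C2 @ w # ys"])
      show "successively F (y # (x # B) @ [w'])"
        using xBw y EF E_sym by simp
      show "set (x # B) \<inter> set (y # zs @ w' # C2 @ w # ys) = {}" using AB x CC by (auto simp: C1)
    qed (use circ' len AB in \<open>auto simp: C1\<close>)
    then show "length B + 1 \<le> length zs" by simp
  next
    have "length (A @ x # B) \<le> length C1"
      by (rule arc_ge[OF circ len]) (use AB path x CC in auto)
    then show "length A + 1 + (length B + 1) \<le> length C1 + 1" by simp
  qed
  then show ?thesis by simp
qed

text \<open>The ends of the ear cut \<open>C\<close> into two arcs. \<open>arc_long\<close> applies
  to both, with the ear reversed for the second; the ends themselves add at most two neighbours of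
  \<open>x\<close>.\<close>

lemma circuit_long:
  assumes ear: "ear w A B w'"
  shows "2 * card {z \<in> set C. E x z} + 2 * (length A + length B) \<le> length C"
proof -
  have ww: "w \<in> set C" "w' \<in> set C" "w \<noteq> w'" using ear by (auto simp: ear_def)
  obtain us vs where C1: "C = us @ w # vs" using ww by (meson split_list)
  then have "w' \<in> set (vs @ us)" using ww by auto
  then obtain C1 C2 where C2: "vs @ us = C1 @ w' # C2" by (meson split_list)
  have "circuit F ((w # vs) @ us)" using circuit_append_commute[of F us "w # vs"] C by (simp add: C1)
  then have c1: "circuit F (w # C1 @ w' # C2)" by (simp add: C2)
  then have c2: "circuit F (w' # C2 @ w # C1)"
    using circuit_append_commute[of F "w # C1" "w' # C2"] by simp
  have sets: "set C = set (w # C1 @ w' # C2)"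
  proof -
    have "set C = set (w # vs @ us)" by (auto simp: C1)
    then show ?thesis unfolding C2 .
  qed
  have len: "length C = length (w # C1 @ w' # C2)"
  proof -
    have "length C = length (w # vs @ us)" by (simp add: C1)
    then show ?thesis unfolding C2 .
  qed
  have "2 * length (filter (E x) C1) + length A + length B + 1 \<le> length C1"
    using c1 len[symmetric] sets[symmetric] ear by (rule arc_long)
  moreover have "2 * length (filter (E x) C2) + length (rev B) + length (rev A) + 1 \<le> length C2"
    using c2 _ _ ear_reverse[OF ear] by (rule arc_long) (use len sets in auto)
  moreover have "card {z \<in> set C. E x z} \<le> length (filter (E x) C1) + length (filter (E x) C2) + 2"
  proof -
    have "{z \<in> set C. E x z} \<subseteq> set (w # w' # filter (E x) C1 @ filter (E x) C2)"
      using sets by auto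
    then have "card {z \<in> set C. E x z} \<le> length (w # w' # filter (E x) C1 @ filter (E x) C2)"
      by (meson card_length card_mono finite_set le_trans)
    then show ?thesis by simp
  qed
  ultimately show ?thesis using len by simp
qed

text \<open>Count \<open>V\<close> from below and the neighbours of \<open>x\<close> from above over
  circuit, ear and \<open>outer A B\<close>; \<open>heavy\<close> compares the two counts and
  \<open>circuit_long\<close> cancels the contribution of \<open>C\<close>.\<close>

lemma outer_large:
  assumes ear: "ear w A B w'"
  shows "length A + length B + 1 + 2 * card {z \<in> set A \<union> set B. \<not> E x z} \<le> card (outer A B)"
proof -
  let ?P = "set A \<union> set B"
  define m where "m = card {z \<in> ?P. \<not> E x z}"
  have AB: "distinct A" "distinct B" "x \<notin> ?P" "?P \<inter> set C = {}" "set A \<inter> set B = {}" "?P \<subseteq> V"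
    using ear by (auto simp: ear_def)
  have cP: "card ?P = length A + length B"
    using AB by (simp add: card_Un_disjoint distinct_card)
  have fin: "finite (outer A B)" using finite_V by (auto simp: outer_def)
  have "card (set C \<union> ?P \<union> {x} \<union> outer A B) \<le> card V"
    using C x AB finite_V by (intro card_mono) (auto simp: outer_def)
  moreover have "card (set C \<union> ?P \<union> {x} \<union> outer A B) = card (set C \<union> ?P \<union> {x}) + card (outer A B)"
    using fin by (subst card_Un_disjoint) (auto simp: outer_def)
  moreover have "card (set C \<union> ?P \<union> {x}) = card (set C \<union> ?P) + 1"
    using x AB by (subst card_Un_disjoint) auto
  moreover have "card (set C \<union> ?P) = length C + (length A + length B)"
    using AB C(1) cP by (subst card_Un_disjoint) (auto simp: circuit_def distinct_card)
  ultimately have V: "length C + (length A + length B) + 1 + card (outer A B) \<le> card V"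
    by simp
  have "{z. E x z} = {z \<in> set C. E x z} \<union> {z \<in> ?P. E x z} \<union> outer A B"
    using E_irrefl E_in2 C AB by (auto simp: outer_def)
  then have "deg x \<le> card {z \<in> set C. E x z} + card {z \<in> ?P. E x z} + card (outer A B)"
    by (metis (no_types, lifting) card_Un_le add_le_mono1 le_trans)
  moreover have "card ?P = card {z \<in> ?P. E x z} + m"
  proof -
    have "card ({z \<in> ?P. E x z} \<union> {z \<in> ?P. \<not> E x z}) = card {z \<in> ?P. E x z} + m"
      unfolding m_def by (rule card_Un_disjoint) auto
    moreover have "{z \<in> ?P. E x z} \<union> {z \<in> ?P. \<not> E x z} = ?P" by blast
    ultimately show ?thesis by simp
  qed
  ultimately show ?thesis
    using circuit_long[OF ear] V heavy cP by (simp add: m_def)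
qed

section \<open>Rerouting the ear along a leg\<close>

lemma leg_reverse: "leg (rev B) (rev A) L q \<longleftrightarrow> leg A B L q"
  by (auto simp: leg_def)

lemma outer_reverse: "outer (rev B) (rev A) = outer A B"
  by (auto simp: outer_def)

text \<open>The leg can take the place of \<open>B\<close>, giving an ear from \<open>w\<close> to
  \<open>q\<close>.\<close>

lemma leg_to_circuit:
  assumes "max_ear w A B w'" "leg A B L q" "q \<in> set C" "q \<noteq> w"
  shows "length L \<le> length B"
proof -
  have "ear w A L q"
    using assms unfolding max_ear_def ear_def leg_def by auto
  then show ?thesis using assms(1) by (fastforce simp: max_ear_def)
qed

text \<open>The leg can take the place of \<open>B1\<close>. The rest \<open>Q\<close> starts at
  \<open>q\<close> and is empty exactly when the leg ends at \<open>w'\<close>.\<close>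

lemma leg_to_right:
  assumes m: "max_ear w A B w'" and leg: "leg A B L q" and B: "B = B1 @ Q" "q = hd (Q @ [w'])"
  shows "length L \<le> length B1"
proof -
  have Q: "successively F (L @ Q @ [w'])"
  proof -
    have "successively F (Q @ [w'])"
      using m B unfolding max_ear_def ear_def by (simp add: successively_append_iff)
    then show ?thesis using leg B by (auto simp: leg_def successively_append_iff)
  qed
  have "ear w A (L @ Q) w'"
    using m leg B Q unfolding max_ear_def ear_def leg_def by auto
  then show ?thesis using m B by (fastforce simp: max_ear_def)
qed

text \<open>Here \<open>x\<close> is bypassed by the edge between its two neighbours on the ear, and the ear is
  left for \<open>x\<close> only at the last neighbour \<open>t\<close> of \<open>x\<close> before \<open>q\<close>; maximality then bounds the
  leg by the number of non-neighbours of \<open>x\<close> between \<open>t\<close> and \<open>q\<close>.\<close>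

lemma leg_to_right_bypass:
  assumes m: "max_ear w A B w'" and leg: "leg A B L q" and B: "B = B1 @ Q" "q = hd (Q @ [w'])"
    and bypass: "F (last (w # A)) (hd (B @ [w']))"
  shows "length L \<le> card {z \<in> set A \<union> set B. \<not> E x z}"
proof -
  have e: "ear w A B w'" using m by (simp add: max_ear_def)
  have "length L \<le> length B1" using m leg B by (rule leg_to_right)
  moreover have "L \<noteq> []" using leg by (simp add: leg_def)
  ultimately have "B1 \<noteq> []" by auto
  then have "E x (hd B1)" using e B by (simp add: ear_def)
  then have "\<exists>t\<in>set B1. E x t" using \<open>B1 \<noteq> []\<close> by (meson hd_in_set)
  then obtain B2 t B3 where B1: "B1 = B2 @ t # B3" and t: "E x t" and B3: "\<forall>z\<in>set B3. \<not> E x z"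
    by (rule split_list_last_propE)
  have Q: "successively F (L @ Q @ [w'])"
  proof -
    have "successively F (Q @ [w'])"
      using e B unfolding ear_def by (simp add: successively_append_iff)
    then show ?thesis using leg B by (auto simp: leg_def successively_append_iff)
  qed
  have "successively F (B2 @ t # B3 @ Q @ [w'])"
    using e B B1 by (simp add: ear_def)
  from successively_split(1)[OF this] have "successively F (B2 @ [t])" .
  moreover have "hd (B @ [w']) = hd (B2 @ [t])" using B B1 by (cases B2) auto
  ultimately have "successively F ((w # A) @ B2 @ [t])"
    using bypass e unfolding ear_def successively_append_iff by auto
  \<comment> \<open>The new ear jumps from the end of \<open>A\<close> over \<open>x\<close> to
    \<open>B2\<close>, returns from \<open>t\<close> to \<open>x\<close> and continues along
    \<open>L\<close>; of the old ear only \<open>B3\<close> is lost.\<close>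
  then have "ear w (A @ B2 @ [t]) (L @ Q) w'"
    using e leg B B1 Q t E_sym[OF t] unfolding ear_def leg_def by auto
  then have "length (A @ B2 @ [t]) + length (L @ Q) \<le> length A + length B"
    using m unfolding max_ear_def by blast
  then have "length L \<le> length B3" using B B1 by simp
  also have "\<dots> = card (set B3)" using e B B1 by (simp add: ear_def distinct_card)
  also have "\<dots> \<le> card {z \<in> set A \<union> set B. \<not> E x z}"
    using B3 B B1 by (intro card_mono) auto
  finally show ?thesis .
qed

text \<open>Both rerouting bounds are compared with \<open>outer_large\<close>: the plain one with
  its summand \<open>length A + length B\<close>, the bypass one with twice the number of
  non-neighbours.\<close>

lemma leg_short_right:
  assumes m: "max_ear w A B w'" and leg: "leg A B L q" and q: "q \<in> set B \<union> {w'}"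
  shows "length L < card (outer A B)"
    and "F (last (w # A)) (hd (B @ [w'])) \<Longrightarrow> 2 * length L < card (outer A B)"
proof -
  have big: "length A + length B + 1 + 2 * card {z \<in> set A \<union> set B. \<not> E x z} \<le> card (outer A B)"
    using m outer_large[of w A B w'] by (simp add: max_ear_def)
  obtain B1 Q where B: "B = B1 @ Q" "q = hd (Q @ [w'])"
  proof (cases "q \<in> set B")
    case True
    then obtain B1 B2 where "B = B1 @ q # B2" by (meson split_list)
    then show ?thesis using that[of B1 "q # B2"] by simp
  next
    case False
    then show ?thesis using that[of B "[]"] q by simp
  qed
  show "length L < card (outer A B)" using leg_to_right[OF m leg B] big B by simp
  show "2 * length L < card (outer A B)" if "F (last (w # A)) (hd (B @ [w']))"
    using leg_to_right_bypass[OF m leg B that] big by simp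
qed

lemma leg_short:
  assumes m: "max_ear w A B w'" and leg: "leg A B L q"
  shows "length L < card (outer A B)"
    and "F (last (w # A)) (hd (B @ [w'])) \<Longrightarrow> 2 * length L < card (outer A B)"
proof -
  have m': "max_ear w' (rev B) (rev A) w" using m by (rule max_ear_reverse)
  have leg': "leg (rev B) (rev A) L q" using leg by (simp add: leg_reverse)
  have big: "length A + length B + 1 \<le> card (outer A B)"
    using m outer_large[of w A B w'] by (simp add: max_ear_def)
  have rv: "last (w' # rev B) = hd (B @ [w'])" "hd (rev A @ [w]) = last (w # A)"
    by (auto simp: last_rev hd_rev hd_append)
  consider "q \<in> set B \<union> {w'}" | "q \<in> set (rev A) \<union> {w}" | "q \<in> set C" "q \<noteq> w" "q \<noteq> w'"
    using leg by (auto simp: leg_def)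
  then have "length L < card (outer A B) \<and>
    (F (last (w # A)) (hd (B @ [w'])) \<longrightarrow> 2 * length L < card (outer A B))"
  proof cases
    case 1
    then show ?thesis using leg_short_right[OF m leg] by blast
  next
    case 2
    then show ?thesis using leg_short_right[OF m' leg'] F_sym unfolding rv outer_reverse by blast
  next
    \<comment> \<open>Such a leg can replace either side of the ear, so it is at most as long as
      each of \<open>A\<close> and \<open>B\<close>; this gives the doubled bound even without the
      bypass.\<close>
    case 3
    then show ?thesis using leg_to_circuit[OF m leg] leg_to_circuit[OF m' leg'] big by simp
  qed
  then show "length L < card (outer A B)"
    and "F (last (w # A)) (hd (B @ [w'])) \<Longrightarrow> 2 * length L < card (outer A B)" by blast+
qed

text \<open>As \<open>x\<close> is not a cut vertex, some path avoiding \<open>x\<close> leads from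
  a vertex \<open>a\<close> of \<open>R\<close> to the circuit or ear. The other members of
  \<open>R\<close>, in any order, can precede \<open>a\<close>, and whichever comes first is a
  neighbour of \<open>x\<close>.\<close>

lemma leg_through_clique:
  assumes R: "R \<subseteq> outer A B" "R \<noteq> {}" and clique: "\<And>r s. r \<in> R \<Longrightarrow> s \<in> R \<Longrightarrow> r \<noteq> s \<Longrightarrow> F r s"
    and AB: "set A \<union> set B \<subseteq> V - {x}"
  shows "\<exists>L q. leg A B L q \<and> card R \<le> length L"
proof -
  let ?T = "set C \<union> set A \<union> set B"
  have finR: "finite R" using R finite_V by (auto simp: outer_def intro: finite_subset)
  have "x \<in> V" "R \<subseteq> V - {x}" "?T \<subseteq> V - {x}" "R \<inter> ?T = {}" "R \<noteq> {}" "?T \<noteq> {}"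
    using R x C AB by (auto simp: outer_def circuit_def)
  then obtain a L b where L: "a \<in> R" "b \<in> ?T" "distinct L" "set L \<subseteq> V - {x} - (R \<union> ?T)"
    "successively E (a # L @ [b])"
    by (rule path_avoiding)
  obtain rs where rs: "set rs = R - {a}" "distinct rs"
    using finite_distinct_list[of "R - {a}"] finR by auto
  have "successively F (rs @ [a])"
    unfolding successively_conv_nth
  proof (intro allI impI)
    fix i assume i: "Suc i < length (rs @ [a])"
    have "set (rs @ [a]) = R" "distinct (rs @ [a])" using rs L(1) by auto
    then show "F ((rs @ [a]) ! i) ((rs @ [a]) ! Suc i)"
      using i clique nth_mem[of i "rs @ [a]"] nth_mem[OF i] nth_eq_iff_index_eq[of "rs @ [a]" i "Suc i"]
      by force
  qed
  moreover have "successively F (a # L @ [b])" using L(5) EF by (auto intro: successively_mono)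
  ultimately have "successively F (rs @ a # L @ [b])" by (rule successively_join)
  moreover have "hd (rs @ a # L) \<in> R" using rs L(1) by (cases rs) auto
  ultimately have "leg A B (rs @ a # L) b"
    using L rs R by (auto simp: leg_def outer_def)
  moreover have "card R \<le> length (rs @ a # L)"
  proof -
    have "R \<subseteq> set (rs @ a # L)" using rs by auto
    then show ?thesis by (meson card_length card_mono finite_set le_trans)
  qed
  ultimately show ?thesis by blast
qed

section \<open>A longest ear and a longest leg\<close>

lemma inconsistent: False
proof -
  have "2 \<le> card (set C)" using C(1) by (simp add: circuit_def distinct_card)
  then obtain w0 A0 B0 w0' where w0: "w0 \<in> set C" "w0' \<in> set C" "w0 \<noteq> w0'" "distinct (A0 @ x # B0)"
    "set (A0 @ x # B0) \<subseteq> V - set C" "successively E (w0 # A0 @ x # B0 @ [w0'])"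
    using ear_through[of "set C" x] C x by auto
  have succ: "successively E ((w0 # A0) @ [x])" "successively E ([x] @ B0 @ [w0'])"
    using successively_split[of E "w0 # A0" x "B0 @ [w0']"] w0(6) by auto
  have "ear w0 A0 B0 w0'"
    using w0 succ unfolding ear_def successively_append_iff[of _ "w0 # A0" "[x]"]
      successively_append_iff[of _ "[x]" "B0 @ [w0']"]
    by (auto intro: successively_mono EF)
  moreover have bound: "length A + length B \<le> card V" if "ear w A B w'" for w A B w'
  proof -
    have "length (A @ B) = card (set (A @ B))"
      using that by (intro distinct_card[symmetric]) (auto simp: ear_def)
    also have "\<dots> \<le> card V" using that finite_V by (intro card_mono) (auto simp: ear_def)
    finally show ?thesis by simp
  qed
  ultimately obtain w A B w' where m: "max_ear w A B w'"
  proof -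
    let ?f = "\<lambda>(w, A, B, w'). length A + length B"
    have "\<exists>p. (case p of (w, A, B, w') \<Rightarrow> ear w A B w') \<and>
      (\<forall>p'. (case p' of (w, A, B, w') \<Rightarrow> ear w A B w') \<longrightarrow> ?f p' \<le> ?f p)"
      using \<open>ear w0 A0 B0 w0'\<close> bound
      by (intro ex_has_greatest_nat[of _ "(w0, A0, B0, w0')" _ "Suc (card V)"]) (auto simp: less_Suc_eq_le)
    then show ?thesis using that unfolding max_ear_def by fastforce
  qed
  then have e: "ear w A B w'" by (simp add: max_ear_def)
  define D where "D = outer A B"
  \<comment> \<open>The neighbours of \<open>x\<close> along the ear; on an empty side this is the
    end \<open>w\<close> or \<open>w'\<close> on the circuit.\<close>
  define s t where "s = last (w # A)" and "t = hd (B @ [w'])"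
  have AB: "set A \<union> set B \<subseteq> V - {x}" using e by (auto simp: ear_def)
  have ts: "E x s" "E x t" "s \<noteq> t" "s \<notin> D" "t \<notin> D"
  proof -
    show "E x s" "E x t" using e E_sym by (auto simp: ear_def s_def t_def)
    have "s \<in> set (w # A)" "t \<in> set (B @ [w'])"
      unfolding s_def t_def by (metis last_in_set list.distinct(1), metis append_is_Nil_conv hd_in_set list.distinct(1))
    then show "s \<noteq> t" "s \<notin> D" "t \<notin> D"
      using e by (auto simp: ear_def D_def outer_def)
  qed
  have finD: "finite D" using finite_V by (auto simp: D_def outer_def)
  have DE: "E x z" if "z \<in> D" for z using that by (simp add: D_def outer_def)
  \<comment> \<open>Otherwise \<open>z\<close> could be inserted between \<open>x\<close> and
    \<open>t\<close>. The statement is general so that the reversed ear gives the same for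
    \<open>s\<close>.\<close>
  have no_t: "\<not> F z t" if "max_ear w A B w'" "z \<in> outer A B" "t = hd (B @ [w'])" for w A B w' z t
  proof
    assume "F z t"
    then have "ear w A (z # B) w'"
      using that unfolding max_ear_def ear_def outer_def by (auto simp: successively_Cons)
    then have "length A + length (z # B) \<le> length A + length B" using that(1) unfolding max_ear_def by blast
    then show False by simp
  qed
  have Dt: "\<not> F z t" if "z \<in> D" for z using no_t[OF m] that by (simp add: D_def t_def)
  have Ds: "\<not> F z s" if "z \<in> D" for z
  proof (rule no_t[OF max_ear_reverse[OF m]])
    show "z \<in> outer (rev B) (rev A)" using that by (simp add: outer_reverse D_def)
    show "s = hd (rev A @ [w])" by (auto simp: s_def hd_append hd_rev)
  qed
  have "D \<noteq> {}" using outer_large[OF e] by (auto simp: D_def)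
  then obtain z where z: "z \<in> D" by blast
  \<comment> \<open>A single vertex of \<open>D\<close> is a clique, so legs exist and a longest one
    can be chosen.\<close>
  obtain L0 q0 where "leg A B L0 q0"
    using leg_through_clique[of "{z}" A B] z AB by (auto simp: D_def)
  then obtain L q where leg: "leg A B L q" and max: "\<And>L' q'. leg A B L' q' \<Longrightarrow> length L' \<le> length L"
  proof -
    let ?f = "\<lambda>(L, q). length L"
    have "length L < Suc (card V)" if "leg A B L q" for L q
      using that finite_V card_mono[of V "set L"] by (auto simp: leg_def distinct_card less_Suc_eq_le)
    then have "\<exists>p. (case p of (L, q) \<Rightarrow> leg A B L q) \<and>
      (\<forall>p'. (case p' of (L, q) \<Rightarrow> leg A B L q) \<longrightarrow> ?f p' \<le> ?f p)"
      using \<open>leg A B L0 q0\<close> by (intro ex_has_greatest_nat[of _ "(L0, q0)" _ "Suc (card V)"]) auto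
    then show ?thesis using that by fastforce
  qed
  have L: "L \<noteq> []" "distinct L" using leg by (auto simp: leg_def)
  define a where "a = hd L"
  have aL: "a \<in> set L" using L by (simp add: a_def)
  have aD: "a \<in> D"
  proof -
    have "a \<in> V - (set C \<union> set A \<union> set B \<union> {x})" "E x a" using leg aL unfolding leg_def a_def by blast+
    then show ?thesis by (simp add: D_def outer_def)
  qed
  define R where "R = D - set L"
  \<comment> \<open>Otherwise \<open>r\<close> could be put in front of \<open>L\<close>, giving a
    longer leg.\<close>
  have Ra: "\<not> F r a" if "r \<in> R" for r
  proof
    assume "F r a"
    then have "leg A B (r # L) q"
      using leg that unfolding leg_def R_def D_def outer_def a_def by (auto simp: successively_Cons)
    from max[OF this] show False by simp
  qed
  have RD: "r \<in> D" "r \<noteq> a" if "r \<in> R" for r using that aL by (auto simp: R_def)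
  have cD: "card D \<le> length L + card R"
  proof -
    have "card D \<le> card (set L \<union> R)" using finD by (intro card_mono) (auto simp: R_def)
    also have "\<dots> \<le> card (set L) + card R" by (rule card_Un_le)
    finally show ?thesis using L by (simp add: distinct_card)
  qed
  show False
  proof (cases "F s t")
    case True
    have "card R \<le> length L"
    proof (cases "R = {}")
      case False
      have "F r r'" if "r \<in> R" "r' \<in> R" "r \<noteq> r'" for r r'
        using no_claw[of t a r r'] ts DE RD[OF that(1)] RD[OF that(2)] aD Dt Ra[OF that(1)] Ra[OF that(2)]
          that F_sym by (metis distinct_length_2_or_more distinct_singleton)
      then obtain L' q' where "leg A B L' q'" "card R \<le> length L'"
        using leg_through_clique[of R A B] False AB by (auto simp: R_def D_def)
      then show ?thesis using max by (meson le_trans)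
    qed simp
    moreover have "2 * length L < card D"
      using leg_short(2)[OF m leg] True by (simp add: D_def s_def t_def)
    ultimately show False using cD by simp
  next
    case False
    have "R = {}"
    proof (rule ccontr)
      assume "R \<noteq> {}"
      then obtain r where r: "r \<in> R" by blast
      show False
        using no_claw[of s t a r] ts DE RD[OF r] aD Dt Ds Ra[OF r] False F_sym
        by (metis distinct_length_2_or_more distinct_singleton)
    qed
    then show False using cD leg_short(1)[OF m leg] by (simp add: D_def)
  qed
qed

end

section \<open>Cycles and induced stars in arc-based graphs\<close>

lemma (in fin_digraph) out_degree_eq_card_nbrs:
  assumes "nomulti_digraph G"
  shows "out_degree G v = card {u. v \<rightarrow>\<^bsub>G\<^esub> u}"
proof -
  have "inj_on (head G) (out_arcs G v)"
    using nomulti_digraph.no_multi_arcs[OF assms] by (auto simp: inj_on_def arc_to_ends_def)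
  moreover have "head G ` out_arcs G v = {u. v \<rightarrow>\<^bsub>G\<^esub> u}"
    by (auto simp: arcs_ends_conv)
  ultimately show ?thesis unfolding out_degree_def by (metis card_image)
qed

lemma reachable_leaves_set:
  assumes "a \<rightarrow>\<^sup>*\<^bsub>K\<^esub> b" "a \<in> Z" "b \<notin> Z"
  shows "\<exists>u\<in>Z. \<exists>v. v \<notin> Z \<and> u \<rightarrow>\<^bsub>K\<^esub> v"
  using reachable_rtranclI[OF assms(1)] assms(2,3) by (induction rule: rtrancl_induct) auto

text \<open>\<open>connected\<close> refers to the symmetric closure. A path there must leave
  \<open>Z\<close>; the arc it uses comes from an arc of \<open>G\<close> in one direction, and
  symmetry of \<open>G\<close> provides the other.\<close>

lemma (in sym_digraph) connected_imp_edge_leaving: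
  assumes con: "connected (G \<restriction> U)" and Z: "Z \<subseteq> U" "Z \<noteq> {}" "Z \<noteq> U"
  shows "\<exists>a\<in>Z. \<exists>b\<in>U - Z. a \<rightarrow>\<^bsub>G\<^esub> b"
proof -
  let ?K = "with_proj (mk_symmetric (G \<restriction> U))"
  obtain a b where ab: "a \<in> Z" "b \<in> U" "b \<notin> Z" using Z by blast
  have "verts ?K = U" by (simp add: mk_symmetric_def)
  then have "a \<rightarrow>\<^sup>*\<^bsub>?K\<^esub> b"
    using con Z(1) ab unfolding connected_def strongly_connected_def by blast
  then obtain u v where uv: "u \<in> Z" "v \<notin> Z" "u \<rightarrow>\<^bsub>?K\<^esub> v"
    using reachable_leaves_set[of ?K a b Z] ab by blast
  then obtain e where "e \<in> arcs (G \<restriction> U)" "(u, v) \<in> {(tail G e, head G e), (head G e, tail G e)}"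
    by (auto simp: mk_symmetric_def induce_subgraph_def)
  then have "u \<rightarrow>\<^bsub>G\<^esub> v \<or> v \<rightarrow>\<^bsub>G\<^esub> u" "v \<in> U"
    by (auto simp: arcs_ends_conv induce_subgraph_def)
  then show ?thesis using uv arcs_ends_symmetric[OF sym_arcs] by blast
qed

section \<open>Arc cycles and vertex circuits\<close>

lemma (in pre_digraph) cas_imp_successively:
  "cas u p v \<Longrightarrow> successively (\<lambda>e e'. head G e = tail G e') p"
  by (induction p arbitrary: u rule: induct_list012) auto

lemma (in wf_digraph) graph_cycle_imp_circuit:
  assumes "graph_cycle G C"
  shows "circuit (dominates G) (map (tail G) C)"
proof -
  obtain u where u: "awalk u C u" "distinct (tl (awalk_verts u C))" and ne: "C \<noteq> []" and len: "3 \<le> length C"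
    using assms unfolding graph_cycle_def cycle_def by blast
  have arcs: "set C \<subseteq> arcs G" and cas: "cas u C u" using u by (auto simp: awalk_def)
  have "awlast u C = u" using awlast_if_cas[OF cas] .
  then have last: "head G (last C) = u" using ne by (simp add: awalk_verts_conv)
  have hd: "tail G (hd C) = u" using cas ne by (simp add: cas_simp)
  \<comment> \<open>In a closed walk this is the list of tails rotated by one place, so distinctness
    carries over.\<close>
  have "tl (awalk_verts u C) = tl (map (tail G) C) @ [tail G (hd C)]"
    using ne last hd by (simp add: awalk_verts_conv)
  then have "distinct (map (tail G) C)"
    using u(2) ne by (cases C) auto
  moreover have "successively (dominates G) (map (tail G) C)"
    unfolding successively_map using cas_imp_successively[OF cas]
    by (rule successively_mono) (use arcs in \<open>auto simp: arcs_ends_conv\<close>)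
  moreover have "dominates G (last (map (tail G) C)) (hd (map (tail G) C))"
  proof -
    have "last C \<in> arcs G" using arcs ne by auto
    then show ?thesis using ne last hd by (force simp: arcs_ends_conv last_map hd_map)
  qed
  ultimately show ?thesis using len by (simp add: circuit_def)
qed

lemma (in wf_digraph) successively_imp_awalk:
  assumes "xs \<noteq> []" "set xs \<subseteq> verts G" "successively (dominates G) xs"
  shows "\<exists>p. awalk (hd xs) p (last xs) \<and> awalk_verts (hd xs) p = xs"
  using assms
proof (induction xs rule: induct_list012)
  case (2 x)
  then show ?case by (intro exI[of _ "[]"]) (auto simp: awalk_Nil_iff)
next
  case (3 x y zs)
  then obtain p where p: "awalk y p (last (y # zs))" "awalk_verts y p = y # zs" by auto
  obtain e where e: "e \<in> arcs G" "tail G e = x" "head G e = y" using 3 by auto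
  show ?case using p e by (intro exI[of _ "e # p"]) (auto simp: awalk_Cons_iff)
qed simp

lemma (in wf_digraph) circuit_imp_graph_cycle:
  assumes "circuit (dominates G) xs"
  shows "\<exists>D. graph_cycle G D \<and> length D = length xs"
proof -
  have xs: "3 \<le> length xs" "distinct xs" "successively (dominates G) xs" "dominates G (last xs) (hd xs)"
    using assms by (auto simp: circuit_def)
  have ne: "xs \<noteq> []" using xs by auto
  have s: "successively (dominates G) (xs @ [hd xs])" using xs by (simp add: successively_append_iff)
  have "set xs \<subseteq> verts G"
  proof
    fix z assume "z \<in> set xs"
    then obtain ys zs where "xs = ys @ z # zs" by (meson split_list)
    then have "\<exists>b. z \<rightarrow>\<^bsub>G\<^esub> b"
      using s by (cases zs) (auto simp: successively_append_iff successively_Cons)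
    then show "z \<in> verts G" using adj_in_verts by blast
  qed
  then have "set (xs @ [hd xs]) \<subseteq> verts G" using hd_in_set[OF ne] by auto
  then obtain p where p: "awalk (hd xs) p (hd xs)" "awalk_verts (hd xs) p = xs @ [hd xs]"
    using successively_imp_awalk[OF _ _ s] ne by auto
  have "length p = length xs" using p(2) length_awalk_verts[of "hd xs" p] by simp
  moreover have "distinct (tl (xs @ [hd xs]))" using xs ne by (cases xs) auto
  ultimately have "graph_cycle G p"
    using p xs(1) unfolding graph_cycle_def cycle_def by (metis le_zero_eq list.size(3) not_numeral_le_zero)
  with \<open>length p = length xs\<close> show ?thesis by blast
qed

text \<open>Independent leaves make \<open>x\<close> the centre of an induced star. The pair
  supplied by \<open>graph_heavy\<close> is nonadjacent, so it cannot contain the centre.\<close>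

lemma (in graph) graph_heavy_star_4:
  assumes heavy: "graph_heavy (star_graph 4) G"
    and edges: "x \<rightarrow>\<^bsub>G\<^esub> a" "x \<rightarrow>\<^bsub>G\<^esub> b" "x \<rightarrow>\<^bsub>G\<^esub> c" "x \<rightarrow>\<^bsub>G\<^esub> d" and dist: "distinct [a, b, c, d]"
    and indep: "\<And>u v. u \<in> {a, b, c, d} \<Longrightarrow> v \<in> {a, b, c, d} \<Longrightarrow> u \<noteq> v \<Longrightarrow> \<not> u \<rightarrow>\<^bsub>G\<^esub> v"
  shows "\<exists>u\<in>{a, b, c, d}. \<exists>v\<in>{a, b, c, d}. u \<noteq> v \<and> card (verts G) \<le> out_degree G u + out_degree G v"
proof -
  define K where "K = G \<restriction> {x, a, b, c, d}"
  have sym: "v \<rightarrow>\<^bsub>G\<^esub> u" if "u \<rightarrow>\<^bsub>G\<^esub> v" for u v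
    using that arcs_ends_symmetric[OF sym_arcs] by blast
  have irr: "\<not> u \<rightarrow>\<^bsub>G\<^esub> u" for u using adj_not_same by blast
  have distx: "distinct [x, a, b, c, d]" using dist edges irr by auto
  have vK: "{x, a, b, c, d} \<subseteq> verts G" using edges adj_in_verts by blast
  have ind: "induced_subgraph K G" unfolding K_def using vK by (rule induced_induce)
  have wfK: "wf_digraph K" using ind by (auto simp: induced_subgraph_def subgraph_def)
  have K: "verts K = {x, a, b, c, d}" "tail K = tail G" "head K = head G"
    "arcs K = {e \<in> arcs G. tail G e \<in> {x, a, b, c, d} \<and> head G e \<in> {x, a, b, c, d}}"
    by (auto simp: K_def induce_subgraph_def)
  \<comment> \<open>Independence and the absence of loops leave only arcs at \<open>x\<close>;
    symmetry supplies both directions.\<close>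
  have ends: "arc_to_ends G ` arcs K = {x} \<times> {a, b, c, d} \<union> {a, b, c, d} \<times> {x}" (is "?l = ?r")
  proof
    show "?l \<subseteq> ?r"
    proof
      fix uv assume "uv \<in> ?l"
      then obtain e where e: "e \<in> arcs K" "uv = (tail G e, head G e)" by (auto simp: arc_to_ends_def)
      then have "tail G e \<rightarrow>\<^bsub>G\<^esub> head G e" by (auto simp: K arcs_ends_conv)
      moreover have "tail G e \<in> {x, a, b, c, d}" "head G e \<in> {x, a, b, c, d}" using e K by blast+
      moreover from calculation have "tail G e \<noteq> head G e" using irr by metis
      ultimately have "tail G e = x \<or> head G e = x" using indep[of "tail G e" "head G e"] by blast
      with \<open>tail G e \<noteq> head G e\<close> \<open>tail G e \<in> _\<close> \<open>head G e \<in> _\<close> show "uv \<in> ?r"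
        unfolding e(2) mem_Times_iff Un_iff insert_iff fst_conv snd_conv by metis
    qed
    show "?r \<subseteq> ?l"
    proof
      fix uv assume r: "uv \<in> ?r"
      obtain u v where uv: "uv = (u, v)" by (cases uv)
      have "u \<rightarrow>\<^bsub>G\<^esub> v" using r edges sym uv by blast
      then obtain e where "e \<in> arcs G" "tail G e = u" "head G e = v" by blast
      moreover have "u \<in> {x, a, b, c, d}" "v \<in> {x, a, b, c, d}" using r uv by blast+
      ultimately have "e \<in> arcs K" "arc_to_ends G e = uv" using K uv by (auto simp: arc_to_ends_def)
      then show "uv \<in> ?l" by blast
    qed
  qed
  \<comment> \<open>The labelling of \<open>star_graph\<close>: leaves get 1 to 4, and the default 0
    is the centre's label. Arcs are sent to their pairs of labels.\<close>
  define f :: "'a \<Rightarrow> nat" where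
    "f v = (if v = a then 1 else if v = b then 2 else if v = c then 3 else if v = d then 4 else 0)" for v
  have f: "f x = 0" "f a = 1" "f b = 2" "f c = 3" "f d = 4" using distx by (auto simp: f_def)
  define h :: "('a, 'b, nat, nat \<times> nat) digraph_isomorphism" where
    "h = \<lparr>iso_verts = f, iso_arcs = (\<lambda>e. map_prod f f (arc_to_ends G e)), iso_head = snd, iso_tail = fst\<rparr>"
  have f_inj: "inj_on f {x, a, b, c, d}" using f by (auto simp: inj_on_def)
  have arcs_inj: "inj_on (\<lambda>e. map_prod f f (arc_to_ends G e)) (arcs K)"
  proof (rule inj_onI)
    fix e e' assume e: "e \<in> arcs K" "e' \<in> arcs K"
      and eq: "map_prod f f (arc_to_ends G e) = map_prod f f (arc_to_ends G e')"
    have mem: "tail G e \<in> {x, a, b, c, d}" "head G e \<in> {x, a, b, c, d}"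
      "tail G e' \<in> {x, a, b, c, d}" "head G e' \<in> {x, a, b, c, d}" using e K by blast+
    have "tail G e = tail G e'" "head G e = head G e'"
      using eq inj_onD[OF f_inj _ mem(1,3)] inj_onD[OF f_inj _ mem(2,4)] by (auto simp: arc_to_ends_def)
    then show "e = e'" using e K no_multi_arcs by (auto simp: arc_to_ends_def)
  qed
  have "pre_digraph.digraph_isomorphism K h"
    using wfK f_inj arcs_inj by (auto simp: pre_digraph.digraph_isomorphism_def h_def K arc_to_ends_def)
  moreover have "star_graph 4 = app_iso h K"
  proof -
    have "{0..4} = {0, 1, 2, 3, 4::nat}" "{1..4} = {1, 2, 3, 4::nat}" by auto
    moreover have "f ` {x, a, b, c, d} = {0, 1, 2, 3, 4}" using f by auto
    moreover have "(\<lambda>e. map_prod f f (arc_to_ends G e)) ` arcs K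
        = map_prod f f ` ({x} \<times> {a, b, c, d} \<union> {a, b, c, d} \<times> {x})"
      unfolding ends[symmetric] image_image ..
    moreover have "\<dots> = {0} \<times> {1, 2, 3, 4} \<union> {1, 2, 3, 4} \<times> {0}" using f by auto
    ultimately show ?thesis
      by (auto simp: star_graph_def with_proj_def app_iso_def h_def K(1))
  qed
  ultimately have "digraph_iso K (star_graph 4)" unfolding digraph_iso_def by blast
  with heavy ind obtain u v where uv: "u \<in> {x, a, b, c, d}" "v \<in> {x, a, b, c, d}" "u \<noteq> v"
    "\<not> u \<rightarrow>\<^bsub>G\<^esub> v" "card (verts G) \<le> out_degree G u + out_degree G v"
    unfolding graph_heavy_def K(1)[symmetric] by blast
  then have "u \<noteq> x" "v \<noteq> x" using edges sym by blast+
  with uv show ?thesis by blast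
qed

theorem theorem4:
  fixes G :: "('a, 'b) pre_digraph" and C :: "'b list"
  assumes "graph G"
    and "k_connected 2 G"
    and "graph_heavy (star_graph 4) G"
    and "longest_cycle G C"
  shows "heavy_cycle G C"
proof -
  interpret graph G by fact
  have cyc: "graph_cycle G C" and longest: "\<And>D. graph_cycle G D \<Longrightarrow> length D \<le> length C"
    using assms(4) by (auto simp: longest_cycle_def)
  have sym: "v \<rightarrow>\<^bsub>G\<^esub> u" if "u \<rightarrow>\<^bsub>G\<^esub> v" for u v
    using that arcs_ends_symmetric[OF sym_arcs] by blast
  interpret two_connected_graph "verts G" "dominates G"
  proof
    show "finite (verts G)" by simp
    show "v \<rightarrow>\<^bsub>G\<^esub> u" if "u \<rightarrow>\<^bsub>G\<^esub> v" for u v using that by (rule sym)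
    show "u \<in> verts G" if "u \<rightarrow>\<^bsub>G\<^esub> v" for u v using that adj_in_verts by blast
    show "\<not> u \<rightarrow>\<^bsub>G\<^esub> u" for u using adj_not_same by blast
    show "\<exists>a\<in>Z. \<exists>b\<in>verts G - X - Z. a \<rightarrow>\<^bsub>G\<^esub> b"
      if "X \<subseteq> verts G" "card X < 2" "Z \<subseteq> verts G - X" "Z \<noteq> {}" "Z \<noteq> verts G - X" for X Z
      using that assms(2) by (intro connected_imp_edge_leaving) (auto simp: k_connected_def)
  qed
  have deg: "out_degree G v = deg v" for v
    by (rule out_degree_eq_card_nbrs) unfold_locales
  define F where "F u v \<longleftrightarrow> u \<rightarrow>\<^bsub>G\<^esub> v \<or>
    u \<noteq> v \<and> u \<in> verts G \<and> v \<in> verts G \<and> card (verts G) \<le> deg u + deg v" for u v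
  \<comment> \<open>The added pairs as a finite set, the form over which
    \<open>circuit_add_ore_edges\<close> inducts.\<close>
  define P where "P = {(u, v). u \<noteq> v \<and> u \<in> verts G \<and> v \<in> verts G \<and> card (verts G) \<le> deg u + deg v}"
  have F_P: "F = (\<lambda>u v. u \<rightarrow>\<^bsub>G\<^esub> v \<or> (u, v) \<in> P \<or> (v, u) \<in> P)"
    by (auto simp: F_def P_def fun_eq_iff add.commute)
  have "finite P" by (rule finite_subset[of _ "verts G \<times> verts G"]) (auto simp: P_def)
  \<comment> \<open>An \<open>F\<close>-circuit yields one of \<open>G\<close> that is at least as
    long, so \<open>C\<close> is longest among \<open>F\<close>-circuits too.\<close>
  have "length ys \<le> length C" if "circuit F ys" for ys
  proof -
    have "\<exists>zs. circuit (dominates G) zs \<and> length ys \<le> length zs"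
    proof (rule circuit_add_ore_edges[OF \<open>finite P\<close>])
      show "circuit (\<lambda>u v. u \<rightarrow>\<^bsub>G\<^esub> v \<or> (u, v) \<in> P \<or> (v, u) \<in> P) ys"
        using that unfolding F_P .
    qed (simp add: P_def)
    then show ?thesis using circuit_imp_graph_cycle longest by (metis le_trans)
  qed
  note longest_F = this
  have "v \<in> cycle_verts G C" if v: "heavy_vertex G v" for v
  proof (rule ccontr)
    assume nv: "v \<notin> cycle_verts G C"
    interpret off_longest_circuit "verts G" "dominates G" F "map (tail G) C" v
    proof
      show "F u w" if "F w u" for u w using that sym by (auto simp: F_def add.commute)
      show "F u w" if "u \<rightarrow>\<^bsub>G\<^esub> w" for u w using that by (simp add: F_def)
      have "circuit (dominates G) (map (tail G) C)" using cyc by (rule graph_cycle_imp_circuit)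
      then show "circuit F (map (tail G) C)"
        by (auto simp: circuit_def F_def intro: successively_mono)
      show "set (map (tail G) C) \<subseteq> verts G"
        using cyc by (auto simp: graph_cycle_def cycle_def awalk_def)
      show "length ys \<le> length (map (tail G) C)" if "circuit F ys" for ys
        using longest_F that by simp
      show "v \<in> verts G" using v by (simp add: heavy_vertex_def)
      show "v \<notin> set (map (tail G) C)" using nv by (simp add: cycle_verts_def)
      show "card (verts G) \<le> 2 * deg v" using v by (simp add: heavy_vertex_def deg)
      show "F a b \<or> F a c \<or> F a d \<or> F b c \<or> F b d \<or> F c d"
        if "v \<rightarrow>\<^bsub>G\<^esub> a" "v \<rightarrow>\<^bsub>G\<^esub> b" "v \<rightarrow>\<^bsub>G\<^esub> c" "v \<rightarrow>\<^bsub>G\<^esub> d" "distinct [a, b, c, d]" for a b c d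
      proof (rule ccontr)
        \<comment> \<open>Four \<open>F\<close>-independent neighbours are independent in
          \<open>G\<close>, so heaviness gives two of them with large degree sum; but
          \<open>F\<close> joins such a pair.\<close>
        assume no: "\<not> ?thesis"
        have nF: "\<not> F u w" if "u \<in> {a, b, c, d}" "w \<in> {a, b, c, d}" "u \<noteq> w" for u w
        proof -
          have "F u w \<Longrightarrow> F w u" using sym by (auto simp: F_def add.commute)
          then show ?thesis using no that by blast
        qed
        then have "\<exists>u\<in>{a, b, c, d}. \<exists>w\<in>{a, b, c, d}. u \<noteq> w \<and>
            card (verts G) \<le> out_degree G u + out_degree G w"
          by (intro graph_heavy_star_4[OF assms(3) that]) (auto simp: F_def)
        then obtain u w where "u \<in> {a, b, c, d}" "w \<in> {a, b, c, d}" "u \<noteq> w"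
          "card (verts G) \<le> deg u + deg w" unfolding deg by blast
        moreover have "{a, b, c, d} \<subseteq> verts G" using that adj_in_verts by blast
        ultimately show False using nF[of u w] unfolding F_def by blast
      qed
    qed
    show False by (rule inconsistent)
  qed
  with cyc show ?thesis by (simp add: heavy_cycle_def)
qed

end
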